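(* Assume the non-smooth setting, i.e. a subgradient mapping $g(y)\in\partial f(y)$, $y\in Q$, is given and $l_f(y;x):=f(y)+\langle g(y),x-y\rangle$. Let $\hat\beta_{-1}:=\hat\beta_0:=1$ and $\hat\beta_{k+1}:=\hat\beta_k+\hat\beta_k^{-1}$ for $k\ge0$. Put $M_{-1}:=0$ and $M_k:=\max_{0\le i\le k}\|g_i\|_*$ for $k\ge0$. (Simple Averages) Let $\{(z_{k-1},x_k,g_k,\hat x_k)\}_{k\ge0}$ be generated by the general subgradient-based method (Method 1, procedure (a) or (b)) with parameters $\lambda_k:=1$ and $\beta_k:=\gamma\hat\beta_k$ for some $\gamma>0$. Then $$\forall k\ge0,\quad f(\hat x_k)-f(x^* )\le\left(\gamma l_d(z_k;x^* )+\frac{M_k^2}{2\sigma\gamma}\right)\frac{0.5+\sqrt{2k+1}}{k+1}$$ and $$\forall k\ge-1,\quad z_k,\ x_{k+1},\ \hat x_{k+1}\in\left\{x\in Q:\ \|x-x^*\|^2\le\frac{2d(x^* )}{\sigma}+\frac{M_k^2}{\sigma^2\gamma^2}\right\}.$$ (Weighted Averages) Let $\{(z_{k-1},x_k,g_k,\hat x_k)\}_{k\ge0}$ be generated by Method 1 (procedure (a) or (b)) with parameters $\lambda_k:=\frac1{\|g_k\|_*}$ (where $g_k\ne0$ for all $k$) and $\beta_k:=\frac{\hat\beta_k}{\rho\sqrt\sigma}$ for some $\rho>0$. Then $$\forall k\ge0,\quad f(\hat x_k)-f(x^* )\le M_k\frac1{\sqrt\sigma}\left(\frac{l_d(z_k;x^*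 )}{\rho}+\frac\rho2\right)\frac{0.5+\sqrt{2k+1}}{k+1}$$ and $$\forall k\ge-1,\quad z_k,\ x_{k+1},\ \hat x_{k+1}\in\left\{x\in Q:\ \|x-x^*\|^2\le\frac{2d(x^* )+\rho^2}{\sigma}\right\}.$$ Moreover, when procedure (a) of Method 1 is used, the quantity $f(\hat x_k)-f(x^* )$ can be replaced by its upper bound $\frac1{S_k}\sum_{i=0}^k\lambda_if(x_i)-f(x^* )$, that is, for all $k\ge0$, $$f(\hat x_k)-f(x^* )\le\frac1{S_k}\sum_{i=0}^k\lambda_if(x_i)-f(x^* )\le\left(\gamma l_d(z_k;x^* )+\frac{M_k^2}{2\sigma\gamma}\right)\frac{0.5+\sqrt{2k+1}}{k+1}$$ for simple averages ($\lambda_k=1$, $\beta_k=\gamma\hat\beta_k$), and $$f(\hat x_k)-f(x^* )\le\frac1{S_k}\sum_{i=0}^k\lambda_if(x_i)-f(x^* )\le M_k\frac1{\sqrt\sigma}\left(\frac{l_d(z_k;x^* )}{\rho}+\frac\rho2\right)\frac{0.5+\sqrt{2k+1}}{k+1}$$ for weighted averages ($\lambda_k=1/\|g_k\|_*$, $\beta_k=\hat\beta_k/(\rho\sqrt\sigma)$); in this case (procedure (a)), $\min\{f(\hat x_k)-f(x^* ),\ \min_{0\le i\le k}f(x_i)-f(x^* )\}$ is also bounded from above, for all $k\ge0$, by $\left(\gamma l_d(z_k;x^* )+\frac{M_k^2}{2\sigma\gamma}\right)\frac{0.5+\sqrt{2k+1}}{k+1}$ for simple averages and by $M_k\frac1{\sqrt\sigma}\left(\frac{l_d(z_k;x^*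 )}{\rho}+\frac\rho2\right)\frac{0.5+\sqrt{2k+1}}{k+1}$ for weighted averages.
   Context: $E$ is a finite-dimensional real vector space with norm $\|\cdot\|$, $E^*$ its dual with dual norm $\|s\|_*=\max_{\|x\|\le1}\langle s,x\rangle$, $\langle s,x\rangle$ the value of $s\in E^*$ at $x\in E$. $Q\subset E$ is a nonempty closed convex (possibly unbounded) set, and $f:E\to\mathbb{R}\cup\{+\infty\}$ is a proper lower semicontinuous convex function with $Q\subset\operatorname{dom} f$; $\partial f(x)=\{g\in E^*: f(y)\ge f(x)+\langle g,y-x\rangle\ \forall y\in E\}$. The problem $\min_{x\in Q}f(x)$ is assumed to have an optimal solution $x^*\in Q$. Prox-function: $d:E\to\mathbb{R}\cup\{+\infty\}$ is a fixed proper lower semicontinuous convex function which is continuously differentiable on $Q$ (in particular finite on $Q$) and strongly convex on $Q$ with parameter $\sigma>0$, i.e. $d(\tau x+(1-\tau)y)\le \tau d(x)+(1-\tau)d(y)-\frac12\sigma\tau(1-\tau)\|x-y\|^2$ for all $x,y\in Q$, $\tau\in[0,1]$. Put $x_0:=\operatorname{argmin}_{x\in Q}d(x)$; it is assumed that $d(x_0)=0$. For $y\in Q$, $l_d(y;x):=d(y)+\langle\nabla d(y),x-y\rangle$. Weight parameters: $\lambda_k>0$ for $k\ge0$; $S_k:=\sum_{i=0}^k\lambda_i$. Scaling parameters: $\beta_k\ge\beta_{k-1}>0$ for $k\ge 0$. Property 1. Auxiliary functions $\psi_k$ ($k\ge-1$), where $\psi_k$ is determined by $\{\lambda_i\}_{i=0}^k,\{\beta_i\}_{i=-1}^k,\{x_i\}_{i=0}^k,\{z_i\}_{i=0}^{k-1}$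 and has a unique minimizer $z_k:=\operatorname{argmin}_{x\in Q}\psi_k(x)$ on $Q$, satisfy Property 1 (for test points $\{x_k\}_{k\ge0}\subset Q$, whose first element is $x_0=\operatorname{argmin}_{x\in Q}d(x)$) if: (i) $\min_{x\in Q}\psi_{-1}(x)=0$ and $z_{-1}=x_0$; (ii) for every $k\ge-1$ and $x\in Q$, $\psi_{k+1}(x)\ge\min_{z\in Q}\psi_k(z)+\lambda_{k+1}l_f(x_{k+1};x)+\beta_{k+1}d(x)-\beta_k l_d(z_k;x)$; (iii) for every $k\ge0$, $\min_{x\in Q}\psi_k(x)\le\inf_{x\in Q}\{\sum_{i=0}^k\lambda_i l_f(x_i;x)+\beta_k l_d(z_k;x)\}$. Standard construction: $\psi_{-1}:=\beta_{-1}d$ and, for each $k\ge-1$, $\psi_{k+1}$ is given by either the extended Mirror-Descent model $\psi_{k+1}(x):=\min_{z\in Q}\psi_k(z)+\lambda_{k+1}l_f(x_{k+1};x)+\beta_{k+1}d(x)-\beta_kl_d(z_k;x)$ or the Dual-Averaging model $\psi_{k+1}(x):=\psi_k(x)+\lambda_{k+1}l_f(x_{k+1};x)+\beta_{k+1}d(x)-\beta_kd(x)$ (free choice for each $k$). Method 1 (general subgradient-based method) generates $\{(z_{k-1},x_k,g_k,\hat x_k)\}_{k\ge0}$, for $k\ge0$, by procedure (a) $x_k:=z_{k-1}:=\operatorname{argmin}_{x\in Q}\psi_{k-1}(x)$, $\ \hat x_k:=\frac1{S_k}\sum_{i=0}^k\lambda_ix_i$, $\ g_k:=g(x_k)\in\partial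 f(x_k)$; or by procedure (b) $z_{k-1}:=\operatorname{argmin}_{x\in Q}\psi_{k-1}(x)$, $\ \hat x_k:=x_k:=\frac1{S_k}\sum_{i=0}^k\lambda_iz_{i-1}$, $\ g_k:=g(x_k)\in\partial f(x_k)$; where $\{\psi_k\}_{k\ge-1}$ is defined by the standard construction, or by any construction satisfying Property 1, with $l_f(y;x)=f(y)+\langle g(y),x-y\rangle$. *)

theory Defs
  imports "HOL-Analysis.Analysis"
begin

text \<open>
  The space \<open>E\<close> is a type of class \<open>real_normed_vector\<close> (so its norm is arbitrary) that is assumed
  to be finite-dimensional. Its dual is the type of bounded linear functionals
  \<open>'a \<Rightarrow>\<^sub>L real\<close>, whose norm is the dual norm:
\<close>

lemma norm_dual_eq_SUP:
  fixes s :: "'a::real_normed_vector \<Rightarrow>\<^sub>L real"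
  shows "norm s = (SUP x\<in>cball 0 1. blinfun_apply s x)"
proof (rule antisym)
  have le: "blinfun_apply s x \<le> norm s" if "x \<in> cball 0 1" for x
  proof -
    have "blinfun_apply s x \<le> norm s * norm x"
      using norm_blinfun[of s x] by simp
    also have "\<dots> \<le> norm s * 1"
      using that by (intro mult_left_mono) auto
    finally show ?thesis by simp
  qed
  then have bdd: "bdd_above (blinfun_apply s ` cball 0 1)"
    by (auto intro!: bdd_aboveI2)
  show "(SUP x\<in>cball 0 1. blinfun_apply s x) \<le> norm s"
    by (rule cSUP_least) (use le in auto)
  let ?m = "SUP x\<in>cball 0 1. blinfun_apply s x"
  show "norm s \<le> ?m"
  proof (rule norm_blinfun_bound)
    show "0 \<le> ?m"
      by (rule cSUP_upper2[OF bdd, of 0]) (auto simp: blinfun.zero_right)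
    fix x
    have "\<bar>blinfun_apply s x\<bar> \<le> ?m * norm x"
    proof (cases "x = 0")
      case False
      have *: "blinfun_apply s (c *\<^sub>R x) \<le> ?m" if "\<bar>c\<bar> = 1 / norm x" for c
        by (rule cSUP_upper[OF _ bdd]) (use that False in auto)
      have "blinfun_apply s x / norm x \<le> ?m" "- (blinfun_apply s x / norm x) \<le> ?m"
        using *[of "1 / norm x"] *[of "- (1 / norm x)"] by (simp_all add: blinfun.scaleR_right blinfun.minus_right)
      then show ?thesis
        using False by (simp add: abs_le_iff field_simps)
    qed (simp add: blinfun.zero_right)
    then show "norm (blinfun_apply s x) \<le> ?m * norm x" by simp
  qed
qed


section \<open>Extended-valued functions\<close>

definition proper_fun :: "('a \<Rightarrow> ereal) \<Rightarrow> bool" where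
  "proper_fun h \<longleftrightarrow> (\<forall>x. h x \<noteq> -\<infinity>) \<and> (\<exists>x. h x \<noteq> \<infinity>)"

definition lsc_fun :: "('a::topological_space \<Rightarrow> ereal) \<Rightarrow> bool" where
  "lsc_fun h \<longleftrightarrow> (\<forall>x. h x \<le> Liminf (at x) h)"

text \<open>The convention \<open>0 * \<infinity> = 0\<close> of \<open>ereal\<close> makes the cases \<open>t = 0\<close> and \<open>t = 1\<close> trivial.\<close>

definition convex_fun :: "('a::real_vector \<Rightarrow> ereal) \<Rightarrow> bool" where
  "convex_fun h \<longleftrightarrow> (\<forall>x y. \<forall>t\<in>{0..1}.
     h (t *\<^sub>R x + (1 - t) *\<^sub>R y) \<le> ereal t * h x + ereal (1 - t) * h y)"

definition eff_dom :: "('a \<Rightarrow> ereal) \<Rightarrow> 'a set" where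
  "eff_dom h = {x. h x < \<infinity>}"

definition subdifferential ::
    "('a::real_normed_vector \<Rightarrow> ereal) \<Rightarrow> 'a \<Rightarrow> ('a \<Rightarrow>\<^sub>L real) set" where
  "subdifferential h x = {s. \<forall>y. h y \<ge> h x + ereal (blinfun_apply s (y - x))}"

definition strongly_convex_on ::
    "real \<Rightarrow> 'a::real_normed_vector set \<Rightarrow> ('a \<Rightarrow> ereal) \<Rightarrow> bool" where
  "strongly_convex_on \<sigma> Q d \<longleftrightarrow> (\<forall>x\<in>Q. \<forall>y\<in>Q. \<forall>t\<in>{0..1}.
     d (t *\<^sub>R x + (1 - t) *\<^sub>R y)
       \<le> ereal t * d x + ereal (1 - t) * d y
          - ereal (1 / 2 * \<sigma> * t * (1 - t) * (norm (x - y))\<^sup>2))"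

text \<open>
  Since \<open>d\<close> may be infinite outside \<open>Q\<close>, and \<open>Q\<close> need not have interior points, differentiability
  on \<open>Q\<close> is taken relative to \<open>Q\<close>; it holds in particular if \<open>d\<close> is differentiable in a
  neighbourhood of \<open>Q\<close>. Although the gradient \<open>Dd\<close> need not be unique then, the value of \<open>Dd y\<close> at
  \<open>x - y\<close> is unique for \<open>x, y \<in> Q\<close>, as \<open>Q\<close> is convex.
\<close>

definition cont_diff_on ::
    "'a::real_normed_vector set \<Rightarrow> ('a \<Rightarrow> ereal) \<Rightarrow> ('a \<Rightarrow> 'a \<Rightarrow>\<^sub>L real) \<Rightarrow> bool" where
  "cont_diff_on Q d Dd \<longleftrightarrow> Q \<subseteq> eff_dom d \<and>
     (\<forall>y\<in>Q. ((\<lambda>x. real_of_ereal (d x)) has_derivative blinfun_apply (Dd y)) (at y within Q)) \<and>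
     continuous_on Q Dd"

text \<open>
  \<open>lin_model f g\<close> is \<open>l\<^sub>f\<close> and \<open>lin_model d Dd\<close> is \<open>l\<^sub>d\<close>. It is only used at base points \<open>y\<close> where \<open>h\<close>
  is finite.
\<close>

definition lin_model ::
    "('a::real_normed_vector \<Rightarrow> ereal) \<Rightarrow> ('a \<Rightarrow> 'a \<Rightarrow>\<^sub>L real) \<Rightarrow> 'a \<Rightarrow> 'a \<Rightarrow> real" where
  "lin_model h G y x = real_of_ereal (h y) + blinfun_apply (G y) (x - y)"


section \<open>The subgradient-based method\<close>

text \<open>
  Index convention: the sequences \<open>\<psi>\<^sub>k\<close>, \<open>z\<^sub>k\<close>, \<open>\<beta>\<^sub>k\<close>, \<open>M\<^sub>k\<close>, which start at \<open>k = -1\<close>, are shifted by one,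
  i.e. \<open>\<psi> j\<close>, \<open>z j\<close>, \<open>bet j\<close>, \<open>run_max gs j\<close> and \<open>beta_hat j\<close> stand for the elements with index
  \<open>j - 1\<close>. The sequences \<open>\<lambda>\<^sub>k\<close>, \<open>x\<^sub>k\<close>, \<open>g\<^sub>k\<close>, \<open>xh\<^sub>k\<close> (the averages), which start at \<open>k = 0\<close>, are not shifted.
\<close>

fun beta_hat :: "nat \<Rightarrow> real" where
  "beta_hat 0 = 1"
| "beta_hat (Suc 0) = 1"
| "beta_hat (Suc (Suc k)) = beta_hat (Suc k) + inverse (beta_hat (Suc k))"

fun run_max :: "(nat \<Rightarrow> 'a::real_normed_vector \<Rightarrow>\<^sub>L real) \<Rightarrow> nat \<Rightarrow> real" where
  "run_max gs 0 = 0"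
| "run_max gs (Suc k) = Max ((\<lambda>i. norm (gs i)) ` {..k})"

definition admissible_params :: "(nat \<Rightarrow> real) \<Rightarrow> (nat \<Rightarrow> real) \<Rightarrow> bool" where
  "admissible_params lam bet \<longleftrightarrow> (\<forall>k. lam k > 0) \<and> (\<forall>j. bet j > 0) \<and> (\<forall>j. bet j \<le> bet (Suc j))"

text \<open>
  Here \<open>lf\<close> and \<open>ld\<close> are the models \<open>l\<^sub>f\<close> and \<open>l\<^sub>d\<close>. The infimum of \<open>\<psi> j\<close> over \<open>Q\<close> is a minimum
  wherever it occurs, as \<open>z j\<close> is required to be a minimizer. The auxiliary functions matter only
  on \<open>Q\<close>.
\<close>

definition property1 ::
    "'a::real_normed_vector set \<Rightarrow> ('a \<Rightarrow> 'a \<Rightarrow> real) \<Rightarrow> ('a \<Rightarrow> ereal) \<Rightarrow> ('a \<Rightarrow> 'a \<Rightarrow> real) \<Rightarrow> 'a \<Rightarrow>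
     (nat \<Rightarrow> real) \<Rightarrow> (nat \<Rightarrow> real) \<Rightarrow> (nat \<Rightarrow> 'a) \<Rightarrow> (nat \<Rightarrow> 'a) \<Rightarrow> (nat \<Rightarrow> 'a \<Rightarrow> ereal) \<Rightarrow> bool" where
  "property1 Q lf d ld x0 lam bet x z \<psi> \<longleftrightarrow>
     (\<forall>k. x k \<in> Q) \<and> x 0 = x0 \<and>
     (\<forall>j. is_arg_min (\<psi> j) (\<lambda>u. u \<in> Q) (z j) \<and>
          (\<forall>u. is_arg_min (\<psi> j) (\<lambda>u. u \<in> Q) u \<longrightarrow> u = z j)) \<and>
     (INF u\<in>Q. \<psi> 0 u) = 0 \<and> z 0 = x0 \<and>
     (\<forall>j. \<forall>u\<in>Q. \<psi> (Suc j) u \<ge>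
        (INF v\<in>Q. \<psi> j v) + ereal (lam j * lf (x j) u) + ereal (bet (Suc j)) * d u
          - ereal (bet j * ld (z j) u)) \<and>
     (\<forall>k. (INF u\<in>Q. \<psi> (Suc k) u) \<le>
        (INF u\<in>Q. ereal ((\<Sum>i\<le>k. lam i * lf (x i) u) + bet (Suc k) * ld (z (Suc k)) u)))"

text \<open>
  Each update is either the extended Mirror-Descent model or the Dual-Averaging model.
\<close>

definition standard_construction ::
    "'a::real_normed_vector set \<Rightarrow> ('a \<Rightarrow> 'a \<Rightarrow> real) \<Rightarrow> ('a \<Rightarrow> ereal) \<Rightarrow> ('a \<Rightarrow> 'a \<Rightarrow> real) \<Rightarrow>
     (nat \<Rightarrow> real) \<Rightarrow> (nat \<Rightarrow> real) \<Rightarrow> (nat \<Rightarrow> 'a) \<Rightarrow> (nat \<Rightarrow> 'a) \<Rightarrow> (nat \<Rightarrow> 'a \<Rightarrow> ereal) \<Rightarrow> bool" where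
  "standard_construction Q lf d ld lam bet x z \<psi> \<longleftrightarrow>
     (\<forall>u\<in>Q. \<psi> 0 u = ereal (bet 0) * d u) \<and>
     (\<forall>j. (\<forall>u\<in>Q. \<psi> (Suc j) u =
              (INF v\<in>Q. \<psi> j v) + ereal (lam j * lf (x j) u) + ereal (bet (Suc j)) * d u
                - ereal (bet j * ld (z j) u)) \<or>
          (\<forall>u\<in>Q. \<psi> (Suc j) u =
              \<psi> j u + ereal (lam j * lf (x j) u) + ereal (bet (Suc j)) * d u - ereal (bet j) * d u))"

datatype procedure = Proc_a | Proc_b

text \<open>
  In procedure (b), \<open>lam k\<close> may depend on \<open>gs k\<close> and hence on \<open>x k\<close>, so the method is stated
  as a relation between the sequences.
\<close>

definition subgradient_method ::
    "procedure \<Rightarrow> 'a::real_normed_vector set \<Rightarrow> ('a \<Rightarrow> ereal) \<Rightarrow> ('a \<Rightarrow> 'a \<Rightarrow>\<^sub>L real) \<Rightarrow>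
     ('a \<Rightarrow> ereal) \<Rightarrow> ('a \<Rightarrow> 'a \<Rightarrow>\<^sub>L real) \<Rightarrow> 'a \<Rightarrow> (nat \<Rightarrow> real) \<Rightarrow> (nat \<Rightarrow> real) \<Rightarrow>
     (nat \<Rightarrow> 'a \<Rightarrow> ereal) \<Rightarrow> (nat \<Rightarrow> 'a) \<Rightarrow> (nat \<Rightarrow> 'a) \<Rightarrow> (nat \<Rightarrow> 'a \<Rightarrow>\<^sub>L real) \<Rightarrow> (nat \<Rightarrow> 'a) \<Rightarrow> bool" where
  "subgradient_method p Q f g d Dd x0 lam bet \<psi> z x gs xh \<longleftrightarrow>
     admissible_params lam bet \<and>
     (standard_construction Q (lin_model f g) d (lin_model d Dd) lam bet x z \<psi> \<or>
      property1 Q (lin_model f g) d (lin_model d Dd) x0 lam bet x z \<psi>) \<and>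
     (\<forall>k. is_arg_min (\<psi> k) (\<lambda>u. u \<in> Q) (z k)) \<and>
     (\<forall>k. gs k = g (x k)) \<and>
     (case p of
        Proc_a \<Rightarrow> \<forall>k. x k = z k \<and>
          xh k = (1 / (\<Sum>i\<le>k. lam i)) *\<^sub>R (\<Sum>i\<le>k. lam i *\<^sub>R x i)
      | Proc_b \<Rightarrow> \<forall>k. xh k = x k \<and>
          x k = (1 / (\<Sum>i\<le>k. lam i)) *\<^sub>R (\<Sum>i\<le>k. lam i *\<^sub>R z i))"

end

theory Submission
  imports Defs
begin

text \<open>
  The minimal values \<open>psi_min j\<close> of the auxiliary functions are squeezed from both sides.

  From above, part (iii) of Property 1 at \<open>xstar\<close>, together with \<open>lf \<le> f\<close>, gives
  \<open>psi_min (Suc k) \<le> S k * f xstar + bet (Suc k) * ld (z (Suc k)) xstar\<close>, where \<open>S k\<close> is the total weight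
  (\<open>psi_min_Suc_le_xstar\<close>).

  From below, part (ii) shows that \<open>psi_min\<close> grows in each step by at least the weighted model of
  \<open>f\<close> at the new minimizer plus a Bregman distance of \<open>d\<close>. The strong convexity of \<open>d\<close> makes this distance
  quadratic in the displacement of the minimizers, which absorbs the linear term of the model up to
  the error \<open>(lam i)\<^sup>2 * (norm (gs i))\<^sup>2 / (2 * \<sigma> * bet i)\<close> (\<open>psi_min_step\<close>). Hence
  \<open>S k * f (xh k) \<le> psi_min (Suc k) + acc_err k\<close>; for procedure (a) even the weighted sum of the values
  \<open>f (x i)\<close> obeys this bound, and for procedure (b) the averages move exactly so that the same single
  displacement remains (\<open>sum_F_x_le\<close>, \<open>sum_lam_F_x_le\<close>).

  Combining the two bounds, \<open>S k * (f (xh k) - f xstar)\<close> is at most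
  \<open>bet (Suc k) * ld (z (Suc k)) xstar + acc_err k\<close>. In both averaging schemes \<open>bet\<close> is a multiple of
  \<open>beta_hat\<close>, whose reciprocals telescope, so that \<open>acc_err k\<close> is also at most a multiple of the same
  element of \<open>beta_hat\<close>, and \<open>beta_hat (Suc k) \<le> 1/2 + sqrt (2 * k + 1)\<close> gives the rate (\<open>rate\<close>). Since
  \<open>f (xh k) \<ge> f xstar\<close>, the combined bound is nonnegative, and as \<open>ld (z (Suc k)) xstar\<close> is at most
  \<open>d xstar\<close> minus \<open>\<sigma>/2\<close> times the squared distance from \<open>z (Suc k)\<close> to \<open>xstar\<close>, this confines the
  minimizers to a ball; the test points and averages are convex combinations of them (\<open>norm_z_le\<close>,
  \<open>iterates_in_ball\<close>).

  The standard construction is covered because it satisfies Property 1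
  (\<open>standard_construction_imp_property1\<close>).
\<close>

section \<open>The scaling sequence\<close>

lemma beta_hat_ge_1: "1 \<le> beta_hat j"
proof (induction j rule: beta_hat.induct)
  case (3 k)
  then show ?case
    by (simp add: add_increasing2)
qed auto

text \<open>The recursion telescopes; the value at \<open>0\<close> contributes the initial \<open>1\<close>.\<close>

lemma sum_inverse_beta_hat: "(\<Sum>i\<le>k. 1 / beta_hat i) = beta_hat (Suc k)"
  by (induction k) (auto simp: inverse_eq_divide)

text \<open>
  Since \<open>t + 1 / t\<close> increases for \<open>t \<ge> 1\<close>, it suffices to follow the upper bound itself through the
  recursion: with \<open>s = sqrt (2 * k + 1)\<close>, the inequality \<open>s + 1 / (s + 1/2) \<le> sqrt (s\<^sup>2 + 2)\<close> is
  equivalent to \<open>s \<ge> 1/2\<close>.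
\<close>

lemma beta_hat_le: "beta_hat (Suc k) \<le> 0.5 + sqrt (2 * real k + 1)"
proof (induction k)
  case 0
  show ?case by simp
next
  case (Suc k)
  define s where "s = sqrt (2 * real k + 1)"
  define b where "b = beta_hat (Suc k)"
  have s: "1 \<le> s" "s\<^sup>2 = 2 * real k + 1"
    by (auto simp: s_def)
  have b: "1 \<le> b" "b \<le> 0.5 + s"
    using Suc beta_hat_ge_1 by (auto simp: s_def b_def)
  \<comment> \<open>The product is nonnegative since both factors are; expanded, it is the monotonicity of
    \<open>t + 1 / t\<close> from \<open>b\<close> to \<open>s + 1/2\<close>.\<close>
  have "0 \<le> ((0.5 + s) - b) * ((0.5 + s) * b - 1)"
    using b s(1) mult_mono[of 1 "0.5 + s" 1 b] by (intro mult_nonneg_nonneg) auto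
  then have "b + 1 / b \<le> (0.5 + s) + 1 / (0.5 + s)"
    using b s(1) by (simp add: field_simps)
  also have "s + 1 / (0.5 + s) \<le> sqrt (s\<^sup>2 + 2)"
  proof (rule real_le_rsqrt)
    define r where "r = 1 / (0.5 + s)"
    have r: "r * (0.5 + s) = 1" "0 < r" "r \<le> 1"
      using s(1) by (auto simp: r_def)
    have "2 * (s * r) = 2 - r"
      using r(1) by (simp add: algebra_simps)
    moreover have "r\<^sup>2 \<le> r"
      using r(2,3) by (simp add: power2_eq_square mult_left_le)
    ultimately have "(s + r)\<^sup>2 \<le> s\<^sup>2 + 2"
      by (simp add: power2_sum)
    then show "(s + 1 / (0.5 + s))\<^sup>2 \<le> s\<^sup>2 + 2"
      by (simp add: r_def)
  qed
  then have "(0.5 + s) + 1 / (0.5 + s) \<le> 0.5 + sqrt (s\<^sup>2 + 2)"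
    by simp
  finally show ?case
    by (simp add: b_def s(2) inverse_eq_divide algebra_simps)
qed

lemma norm_le_run_max: "i \<le> k \<Longrightarrow> norm (gs i) \<le> run_max gs (Suc k)"
  by (auto intro!: Max_ge)


section \<open>Consequences of convexity\<close>

text \<open>
  Restricting \<open>h\<close> to the segment from \<open>y\<close> to \<open>u\<close> and letting \<open>t\<close> tend to \<open>0\<close> removes the quadratic
  term. With \<open>q = r = 0\<close> this gives first-order optimality conditions, and with the terms of
  strong convexity for \<open>q\<close> and \<open>r\<close> the lower bound on the Bregman distance.
\<close>

lemma le_of_has_derivative_within_convex:
  fixes h :: "'a::real_normed_vector \<Rightarrow> real"
  assumes der: "(h has_derivative h') (at y within Q)"
    and "convex Q" "y \<in> Q" "u \<in> Q"
    and le: "\<And>t. 0 \<le> t \<Longrightarrow> t \<le> 1 \<Longrightarrow> h (t *\<^sub>R u + (1 - t) *\<^sub>R y) \<le> h y + t * q + t\<^sup>2 * r"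
  shows "h' (u - y) \<le> q"
proof -
  interpret bounded_linear h'
    using der by (rule has_derivative_bounded_linear)
  define c where "c = (\<lambda>t::real. y + t *\<^sub>R (u - y))"
  have c_eq: "c t = t *\<^sub>R u + (1 - t) *\<^sub>R y" for t
    by (simp add: c_def algebra_simps)
  have c_in: "c ` {0..1} \<subseteq> Q"
    using assms(2-4) by (auto simp: c_eq intro: convexD)
  have "(c has_derivative (\<lambda>t. t *\<^sub>R (u - y))) (at 0 within {0..1})"
    unfolding c_def by (auto intro!: derivative_eq_intros)
  moreover have "(h has_derivative h') (at (c 0) within c ` {0..1})"
    using has_derivative_subset[OF der c_in] by (simp add: c_def)
  ultimately have "((\<lambda>t. h (c t)) has_derivative (\<lambda>t. h' (t *\<^sub>R (u - y)))) (at 0 within {0..1})"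
    using diff_chain_within by (force simp: o_def)
  moreover have "(\<lambda>t. h' (t *\<^sub>R (u - y))) = (*) (h' (u - y))"
    by (auto simp: scaleR)
  ultimately have "((\<lambda>t. h (c t)) has_real_derivative h' (u - y)) (at 0 within {0..1})"
    by (simp add: has_field_derivative_def)
  then have lim: "((\<lambda>t. (h (c t) - h y) / t) \<longlongrightarrow> h' (u - y)) (at 0 within {0..1})"
    by (simp add: has_field_derivative_iff c_def)
  have "((\<lambda>t. q + t * r) \<longlongrightarrow> q + 0 * r) (at 0 within {0..1})"
    by (intro tendsto_intros)
  then have "h' (u - y) \<le> q + 0 * r"
  proof (rule tendsto_le[OF _ _ lim, rotated])
    show "\<forall>\<^sub>F t in at 0 within {0..1}. (h (c t) - h y) / t \<le> q + t * r"
      unfolding eventually_at_filter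
    proof (intro always_eventually allI impI)
      fix t :: real
      assume "t \<noteq> 0" "t \<in> {0..1}"
      then show "(h (c t) - h y) / t \<le> q + t * r"
        using le[of t] by (simp add: c_eq field_simps power2_eq_square)
    qed
    show "at 0 within {0..1::real} \<noteq> bot"
      by (simp add: trivial_limit_within islimpt_Icc)
  qed
  then show ?thesis by simp
qed

lemma INF_eq_arg_min:
  fixes h :: "'a \<Rightarrow> ereal"
  assumes "is_arg_min h (\<lambda>u. u \<in> Q) z"
  shows "(INF u\<in>Q. h u) = h z"
  using assms by (intro antisym INF_lower INF_greatest) (auto simp: is_arg_min_def not_less)

text \<open>Young's inequality for the dual pairing, \<open>ab \<le> a\<^sup>2/(2c) + c b\<^sup>2/2\<close>.\<close>

lemma blinfun_young:
  fixes s :: "'a::real_normed_vector \<Rightarrow>\<^sub>L real"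
  assumes "c > 0"
  shows "- (l\<^sup>2 * (norm s)\<^sup>2 / (2 * c)) \<le> l * blinfun_apply s v + c / 2 * (norm v)\<^sup>2"
proof -
  have "\<bar>l * blinfun_apply s v\<bar> \<le> \<bar>l\<bar> * (norm s * norm v)"
    using norm_blinfun[of s v] by (auto simp: abs_mult intro!: mult_left_mono)
  moreover have "0 \<le> (\<bar>l\<bar> * norm s - c * norm v)\<^sup>2 / (2 * c)"
    using assms by simp
  then have "\<bar>l\<bar> * (norm s * norm v) \<le> l\<^sup>2 * (norm s)\<^sup>2 / (2 * c) + c / 2 * (norm v)\<^sup>2"
    using assms by (simp add: power2_diff power_mult_distrib field_simps) (simp add: power2_eq_square)
  ultimately show ?thesis by linarith
qed

lemma weighted_average_in_convex:
  fixes v :: "nat \<Rightarrow> 'a::real_vector"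
  assumes "convex C" "\<And>i. i \<le> k \<Longrightarrow> w i > (0::real)" "\<And>i. i \<le> k \<Longrightarrow> v i \<in> C"
  shows "(1 / (\<Sum>i\<le>k. w i)) *\<^sub>R (\<Sum>i\<le>k. w i *\<^sub>R v i) \<in> C"
proof -
  have "0 < (\<Sum>i\<le>k. w i)"
    using assms(2) by (intro sum_pos) auto
  then have "(\<Sum>i\<le>k. (w i / (\<Sum>i\<le>k. w i)) *\<^sub>R v i) \<in> C"
    using assms by (intro convex_sum) (auto simp: sum_divide_distrib[symmetric] less_imp_le)
  then show ?thesis
    by (simp add: scaleR_sum_right)
qed


section \<open>The prox-function and the auxiliary functions\<close>

locale prox_setting =
  fixes Q :: "'a::real_normed_vector set"
    and f d :: "'a \<Rightarrow> ereal"
    and g Dd :: "'a \<Rightarrow> 'a \<Rightarrow>\<^sub>L real"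
    and xstar x0 :: 'a
    and \<sigma> :: real
  assumes convex_Q: "convex Q"
    and f: "proper_fun f" "Q \<subseteq> eff_dom f"
    and xstar: "is_arg_min f (\<lambda>u. u \<in> Q) xstar"
    and d: "proper_fun d" "cont_diff_on Q d Dd"
    and \<sigma>: "\<sigma> > 0" "strongly_convex_on \<sigma> Q d"
    and x0: "is_arg_min d (\<lambda>u. u \<in> Q) x0" "d x0 = 0"
    and g: "\<And>y. y \<in> Q \<Longrightarrow> g y \<in> subdifferential f y"
begin

definition F :: "'a \<Rightarrow> real" where "F u = real_of_ereal (f u)"
definition D :: "'a \<Rightarrow> real" where "D u = real_of_ereal (d u)"
abbreviation lf :: "'a \<Rightarrow> 'a \<Rightarrow> real" where "lf \<equiv> lin_model f g"
abbreviation ld :: "'a \<Rightarrow> 'a \<Rightarrow> real" where "ld \<equiv> lin_model d Dd"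

lemma lf_eq: "lf y u = F y + blinfun_apply (g y) (u - y)"
  and ld_eq: "ld y u = D y + blinfun_apply (Dd y) (u - y)"
  by (simp_all add: lin_model_def F_def D_def)

lemma xstar_in: "xstar \<in> Q" and x0_in: "x0 \<in> Q"
  using xstar x0 by (auto simp: is_arg_min_def)

lemma f_eq: "u \<in> Q \<Longrightarrow> f u = ereal (F u)"
  using f by (cases "f u") (auto simp: proper_fun_def eff_dom_def F_def)

lemma d_eq: "u \<in> Q \<Longrightarrow> d u = ereal (D u)"
  using d by (cases "d u") (auto simp: proper_fun_def cont_diff_on_def eff_dom_def D_def)

lemma F_xstar_le: "u \<in> Q \<Longrightarrow> F xstar \<le> F u"
  using xstar xstar_in
  by (metis f_eq ereal_less_eq(3) is_arg_min_linorder)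

lemma D_x0 [simp]: "D x0 = 0"
  using x0 by (simp add: D_def)

lemma D_nonneg: "u \<in> Q \<Longrightarrow> 0 \<le> D u"
  using x0 by (metis d_eq ereal_less_eq(5) is_arg_min_linorder)

lemma D_has_derivative:
  "y \<in> Q \<Longrightarrow> (D has_derivative blinfun_apply (Dd y)) (at y within Q)"
  using d by (simp add: cont_diff_on_def D_def[abs_def])

lemma lf_le:
  assumes "y \<in> Q" "u \<in> Q"
  shows "lf y u \<le> F u"
proof -
  have "f y + ereal (blinfun_apply (g y) (u - y)) \<le> f u"
    using g[OF assms(1)] by (simp add: subdifferential_def)
  then show ?thesis
    using assms by (simp add: f_eq lf_eq ld_eq)
qed

lemma ld_bregman:
  assumes "y \<in> Q" "u \<in> Q"
  shows "ld y u + \<sigma> / 2 * (norm (u - y))\<^sup>2 \<le> D u"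
proof -
  have "blinfun_apply (Dd y) (u - y) \<le> D u - D y - \<sigma> / 2 * (norm (u - y))\<^sup>2"
  proof (rule le_of_has_derivative_within_convex[OF D_has_derivative[OF assms(1)] convex_Q assms])
    fix t :: real
    assume t: "0 \<le> t" "t \<le> 1"
    define v where "v = t *\<^sub>R u + (1 - t) *\<^sub>R y"
    have v: "v \<in> Q"
      using convex_Q assms t by (auto simp: v_def intro: convexD)
    have "d v \<le> ereal t * d u + ereal (1 - t) * d y
        - ereal (1 / 2 * \<sigma> * t * (1 - t) * (norm (u - y))\<^sup>2)"
      using \<sigma>(2) assms t unfolding strongly_convex_on_def v_def by auto
    then have "D v \<le> t * D u + (1 - t) * D y - 1 / 2 * \<sigma> * t * (1 - t) * (norm (u - y))\<^sup>2"
      using assms v by (simp add: d_eq)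
    also have "\<dots> = D y + t * (D u - D y - \<sigma> / 2 * (norm (u - y))\<^sup>2)
        + t\<^sup>2 * (\<sigma> / 2 * (norm (u - y))\<^sup>2)"
      by (simp add: field_simps power2_eq_square[of t])
    finally show "D (t *\<^sub>R u + (1 - t) *\<^sub>R y) \<le> D y + t * (D u - D y - \<sigma> / 2 * (norm (u - y))\<^sup>2)
        + t\<^sup>2 * (\<sigma> / 2 * (norm (u - y))\<^sup>2)"
      by (simp add: v_def)
  qed
  then show ?thesis
    by (simp add: lf_eq ld_eq)
qed

text \<open>
  First-order optimality of \<open>z\<close>: replacing \<open>D\<close> by its linear model at \<open>z\<close> turns the objective into
  an affine function, and \<open>z\<close> minimizes that function as well.
\<close>

lemma arg_min_affine_plus_prox:
  assumes eq: "\<And>u. u \<in> Q \<Longrightarrow> h u = ereal (a + blinfun_apply s u + b * D u)"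
    and z: "is_arg_min h (\<lambda>u. u \<in> Q) z" and u: "u \<in> Q"
  shows "a + blinfun_apply s z + b * D z \<le> a + blinfun_apply s u + b * ld z u"
proof -
  define H where "H = (\<lambda>u. - (a + blinfun_apply s u + b * D u))"
  have z_in: "z \<in> Q"
    using z by (simp add: is_arg_min_def)
  have le: "H v \<le> H z" if "v \<in> Q" for v
  proof -
    have "h z \<le> h v"
      using z that by (auto simp: is_arg_min_def not_less)
    then show ?thesis
      using that z_in by (simp add: eq H_def)
  qed
  have "(H has_derivative (\<lambda>v. - (blinfun_apply s v + b * blinfun_apply (Dd z) v))) (at z within Q)"
    unfolding H_def using D_has_derivative[OF z_in]
    by (auto intro!: derivative_eq_intros bounded_linear_imp_has_derivative blinfun.bounded_linear_right)
  then have "- (blinfun_apply s (u - z) + b * blinfun_apply (Dd z) (u - z)) \<le> 0"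
  proof (rule le_of_has_derivative_within_convex[OF _ convex_Q z_in u])
    fix t :: real
    assume "0 \<le> t" "t \<le> 1"
    then have "t *\<^sub>R u + (1 - t) *\<^sub>R z \<in> Q"
      using convex_Q u z_in by (auto intro: convexD)
    then show "H (t *\<^sub>R u + (1 - t) *\<^sub>R z) \<le> H z + t * 0 + t\<^sup>2 * 0"
      using le by simp
  qed
  then show ?thesis
    by (simp add: lf_eq ld_eq blinfun.diff_right algebra_simps)
qed

text \<open>
  Both models keep \<open>\<psi> j\<close> of the form affine plus \<open>bet j * d\<close>. The affine part stays below the
  accumulated models of \<open>f\<close>: a Dual-Averaging step adds the new model, and a Mirror-Descent step first
  replaces the old affine part by the minorant obtained from the optimality of \<open>z j\<close>.
\<close>

lemma standard_construction_affine:
  assumes std: "standard_construction Q lf d ld lam bet x z \<psi>"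
    and z: "\<And>j. is_arg_min (\<psi> j) (\<lambda>u. u \<in> Q) (z j)"
  shows "\<exists>a s. \<forall>u\<in>Q. \<psi> j u = ereal (a + blinfun_apply s u + bet j * D u) \<and>
           a + blinfun_apply s u \<le> (\<Sum>i<j. lam i * lf (x i) u)"
proof (induction j)
  case 0
  show ?case
    using std by (intro exI[of _ 0]) (auto simp: standard_construction_def d_eq)
next
  case (Suc j)
  then obtain a s where as:
      "\<And>u. u \<in> Q \<Longrightarrow> \<psi> j u = ereal (a + blinfun_apply s u + bet j * D u)"
      "\<And>u. u \<in> Q \<Longrightarrow> a + blinfun_apply s u \<le> (\<Sum>i<j. lam i * lf (x i) u)"
    by blast
  have z_in: "z j \<in> Q"
    using z[of j] by (simp add: is_arg_min_def)
  define m where "m = a + blinfun_apply s (z j) + bet j * D (z j)"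
  have INF_eq: "(INF v\<in>Q. \<psi> j v) = ereal m"
    using INF_eq_arg_min[OF z[of j]] as(1)[OF z_in] by (simp add: m_def)
  have opt: "m \<le> a + blinfun_apply s u + bet j * ld (z j) u" if "u \<in> Q" for u
    unfolding m_def using arg_min_affine_plus_prox[OF as(1) z that] .
  consider
      (md) "\<And>u. u \<in> Q \<Longrightarrow> \<psi> (Suc j) u =
          (INF v\<in>Q. \<psi> j v) + ereal (lam j * lf (x j) u) + ereal (bet (Suc j)) * d u
            - ereal (bet j * ld (z j) u)"
    | (da) "\<And>u. u \<in> Q \<Longrightarrow> \<psi> (Suc j) u =
          \<psi> j u + ereal (lam j * lf (x j) u) + ereal (bet (Suc j)) * d u - ereal (bet j) * d u"
    using std unfolding standard_construction_def by blast
  then show ?case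
  proof cases
    case md
    define a' where "a' = m + lam j * (F (x j) - blinfun_apply (g (x j)) (x j))
      - bet j * (D (z j) - blinfun_apply (Dd (z j)) (z j))"
    define s' where "s' = lam j *\<^sub>R g (x j) - bet j *\<^sub>R Dd (z j)"
    have eq: "a' + blinfun_apply s' u = m + lam j * lf (x j) u - bet j * ld (z j) u" for u
      by (simp add: a'_def s'_def lf_eq ld_eq blinfun.diff_left blinfun.diff_right
          blinfun.scaleR_left algebra_simps)
    show ?thesis
    proof (intro exI[of _ a'] exI[of _ s'] ballI conjI)
      fix u assume u: "u \<in> Q"
      show "\<psi> (Suc j) u = ereal (a' + blinfun_apply s' u + bet (Suc j) * D u)"
        unfolding eq using md[OF u] u by (simp add: INF_eq d_eq)
      show "a' + blinfun_apply s' u \<le> (\<Sum>i<Suc j. lam i * lf (x i) u)"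
        unfolding eq using opt[OF u] as(2)[OF u] by simp
    qed
  next
    case da
    define a' where "a' = a + lam j * (F (x j) - blinfun_apply (g (x j)) (x j))"
    define s' where "s' = s + lam j *\<^sub>R g (x j)"
    have eq: "a' + blinfun_apply s' u = a + blinfun_apply s u + lam j * lf (x j) u" for u
      by (simp add: a'_def s'_def lf_eq ld_eq blinfun.diff_left blinfun.diff_right
          blinfun.scaleR_left blinfun.add_left algebra_simps)
    show ?thesis
    proof (intro exI[of _ a'] exI[of _ s'] ballI conjI)
      fix u assume u: "u \<in> Q"
      show "\<psi> (Suc j) u = ereal (a' + blinfun_apply s' u + bet (Suc j) * D u)"
        unfolding eq using da[OF u] u by (simp add: as(1) d_eq)
      show "a' + blinfun_apply s' u \<le> (\<Sum>i<Suc j. lam i * lf (x i) u)"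
        unfolding eq using as(2)[OF u] by simp
    qed
  qed
qed

text \<open>
  For \<open>h = affine + b * D\<close> with minimizer \<open>z\<close>, optimality gives \<open>h u \<ge> h z + b * (D u - ld z u)\<close>.
  Hence the Dual-Averaging update dominates the Mirror-Descent one, which is part (ii). By strong
  convexity the difference in brackets is positive for \<open>u \<noteq> z\<close>, so the minimizers are unique. The
  bound on the affine part gives part (iii).
\<close>

lemma standard_construction_imp_property1:
  assumes std: "standard_construction Q lf d ld lam bet x z \<psi>"
    and z: "\<And>j. is_arg_min (\<psi> j) (\<lambda>u. u \<in> Q) (z j)"
    and bet: "\<And>j. bet j > 0"
    and x: "\<And>k. x k \<in> Q" "x 0 = z 0"
  shows "property1 Q lf d ld x0 lam bet x z \<psi>"
proof -
  have z_in: "z j \<in> Q" for j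
    using z[of j] by (simp add: is_arg_min_def)
  define m where "m = (\<lambda>j. real_of_ereal (\<psi> j (z j)))"
  have lower: "\<exists>r. \<psi> j u = ereal r \<and> m j + bet j * (D u - ld (z j) u) \<le> r"
    and upper: "m j \<le> (\<Sum>i<j. lam i * lf (x i) u) + bet j * ld (z j) u"
    and fin: "\<psi> j (z j) = ereal (m j)" if "u \<in> Q" for u j
  proof -
    obtain a s where as:
        "\<And>u. u \<in> Q \<Longrightarrow> \<psi> j u = ereal (a + blinfun_apply s u + bet j * D u)"
        "\<And>u. u \<in> Q \<Longrightarrow> a + blinfun_apply s u \<le> (\<Sum>i<j. lam i * lf (x i) u)"
      using standard_construction_affine[OF std z, of j] by blast
    have m: "m j = a + blinfun_apply s (z j) + bet j * D (z j)"
      by (simp add: m_def as(1) z_in)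
    show "\<psi> j (z j) = ereal (m j)"
      by (simp add: m as(1) z_in)
    have opt: "m j \<le> a + blinfun_apply s u + bet j * ld (z j) u"
      unfolding m using arg_min_affine_plus_prox[OF as(1) z that] .
    then show "m j \<le> (\<Sum>i<j. lam i * lf (x i) u) + bet j * ld (z j) u"
      using as(2)[OF that] by simp
    show "\<exists>r. \<psi> j u = ereal r \<and> m j + bet j * (D u - ld (z j) u) \<le> r"
      using as(1)[OF that] opt by (auto simp: algebra_simps)
  qed
  have INF_eq: "(INF v\<in>Q. \<psi> j v) = ereal (m j)" for j
    using INF_eq_arg_min[OF z[of j]] fin[OF x0_in] by simp
  have uniq: "u = z j" if "is_arg_min (\<psi> j) (\<lambda>u. u \<in> Q) u" for u j
  proof -
    have u: "u \<in> Q"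
      using that by (simp add: is_arg_min_def)
    have "\<psi> j u = ereal (m j)"
      using INF_eq_arg_min[OF that] INF_eq by simp
    then have "bet j * (D u - ld (z j) u) \<le> 0"
      using lower[OF u, of j] by auto
    then have "D u - ld (z j) u \<le> 0"
      using bet[of j] by (simp add: mult_le_0_iff)
    then have "\<sigma> / 2 * (norm (u - z j))\<^sup>2 \<le> 0"
      using ld_bregman[OF z_in[of j] u] by linarith
    then show ?thesis
      using \<sigma>(1) by (simp add: mult_le_0_iff)
  qed
  have psi0: "\<psi> 0 u = ereal (bet 0 * D u)" if "u \<in> Q" for u
    using std that by (simp add: standard_construction_def d_eq)
  have "is_arg_min (\<psi> 0) (\<lambda>u. u \<in> Q) x0"
    using bet[of 0] by (auto simp: is_arg_min_def psi0 x0_in not_less D_nonneg)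
  then have z0: "z 0 = x0"
    using uniq by simp
  have m0: "m 0 = 0"
    by (simp add: m_def z0 psi0 x0_in)
  have ii: "(INF v\<in>Q. \<psi> j v) + ereal (lam j * lf (x j) u) + ereal (bet (Suc j)) * d u
          - ereal (bet j * ld (z j) u) \<le> \<psi> (Suc j) u" if u: "u \<in> Q" for u j
  proof -
    consider
      (md) "\<psi> (Suc j) u =
          (INF v\<in>Q. \<psi> j v) + ereal (lam j * lf (x j) u) + ereal (bet (Suc j)) * d u
            - ereal (bet j * ld (z j) u)"
      | (da) "\<psi> (Suc j) u =
          \<psi> j u + ereal (lam j * lf (x j) u) + ereal (bet (Suc j)) * d u - ereal (bet j) * d u"
      using std u unfolding standard_construction_def by blast
    then show ?thesis
    proof cases
      case da
      obtain r where "\<psi> j u = ereal r" "m j + bet j * (D u - ld (z j) u) \<le> r"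
        using lower[OF u] by blast
      then show ?thesis
        using da u by (simp add: INF_eq d_eq algebra_simps)
    qed simp
  qed
  have iii: "(INF u\<in>Q. \<psi> (Suc k) u)
      \<le> (INF u\<in>Q. ereal ((\<Sum>i\<le>k. lam i * lf (x i) u) + bet (Suc k) * ld (z (Suc k)) u))" for k
    unfolding INF_eq using upper[of _ "Suc k"] by (intro INF_greatest) (simp add: lessThan_Suc_atMost)
  show ?thesis
    unfolding property1_def
    using x z uniq z0 m0 ii iii INF_eq[of 0] by (auto simp: zero_ereal_def)
qed

end


section \<open>Convergence of the subgradient-based method\<close>

locale subgradient_run = prox_setting Q f d g Dd xstar x0 \<sigma>
  for Q :: "'a::real_normed_vector set" and f d g Dd xstar x0 \<sigma> +
  fixes p :: procedure
    and lam bet :: "nat \<Rightarrow> real"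
    and \<psi> :: "nat \<Rightarrow> 'a \<Rightarrow> ereal"
    and z x xh :: "nat \<Rightarrow> 'a"
    and gs :: "nat \<Rightarrow> 'a \<Rightarrow>\<^sub>L real"
  assumes run: "subgradient_method p Q f g d Dd x0 lam bet \<psi> z x gs xh"
begin

lemma lam_pos: "lam k > 0" and bet_pos: "bet j > 0" and bet_mono: "bet j \<le> bet (Suc j)"
  using run by (auto simp: subgradient_method_def admissible_params_def)

lemma arg_min_z: "is_arg_min (\<psi> j) (\<lambda>u. u \<in> Q) (z j)"
  and gs_eq: "gs k = g (x k)"
  using run by (auto simp: subgradient_method_def)

lemma proc_a: "p = Proc_a \<Longrightarrow> x k = z k"
    "p = Proc_a \<Longrightarrow> xh k = (1 / (\<Sum>i\<le>k. lam i)) *\<^sub>R (\<Sum>i\<le>k. lam i *\<^sub>R x i)"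
  and proc_b: "p = Proc_b \<Longrightarrow> xh k = x k"
    "p = Proc_b \<Longrightarrow> x k = (1 / (\<Sum>i\<le>k. lam i)) *\<^sub>R (\<Sum>i\<le>k. lam i *\<^sub>R z i)"
  using run by (auto simp: subgradient_method_def)

lemma sum_lam_pos: "0 < (\<Sum>i\<le>k. lam i)"
  by (intro sum_pos) (auto simp: lam_pos)

lemma z_in: "z j \<in> Q"
  using arg_min_z[of j] by (simp add: is_arg_min_def)

text \<open>Both kinds of test points are convex combinations of \<open>z 0, \<dots>, z k\<close>.\<close>

lemma iterates_in_convex:
  assumes "convex C" "\<And>i. i \<le> k \<Longrightarrow> z i \<in> C"
  shows "x k \<in> C" "xh k \<in> C"
proof (atomize (full), cases p)
  case Proc_a
  then show "x k \<in> C \<and> xh k \<in> C"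
    using weighted_average_in_convex[OF assms(1), of k lam z] assms(2) lam_pos
    by (simp add: proc_a)
next
  case Proc_b
  then show "x k \<in> C \<and> xh k \<in> C"
    using weighted_average_in_convex[OF assms(1), of k lam z] assms(2) lam_pos
    by (metis proc_b)
qed

lemma x_in: "x k \<in> Q" and xh_in: "xh k \<in> Q"
  using iterates_in_convex[OF convex_Q] z_in by blast+

lemma x_0: "x 0 = z 0"
  by (cases p) (auto simp: proc_a(1) proc_b(2)[of 0] lam_pos less_imp_neq[symmetric])

lemma property1: "property1 Q lf d ld x0 lam bet x z \<psi>"
  using run standard_construction_imp_property1[of lam bet x z \<psi>] arg_min_z bet_pos x_in x_0
  by (auto simp: subgradient_method_def)

definition psi_min :: "nat \<Rightarrow> real" where
  "psi_min j = real_of_ereal (\<psi> j (z j))"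

lemma z_0: "z 0 = x0"
  using property1 by (simp add: property1_def)

text \<open>
  Finiteness of the minimal values comes by induction from the two bounds of the property: part (ii)
  excludes \<open>-\<infinity>\<close> and part (iii) excludes \<open>\<infinity>\<close>.
\<close>

lemma INF_eq: "(INF u\<in>Q. \<psi> j u) = ereal (psi_min j)"
  and psi_min_0: "psi_min 0 = 0"
  and psi_min_Suc_ge: "psi_min j + lam j * lf (x j) (z (Suc j)) + bet (Suc j) * D (z (Suc j))
      - bet j * ld (z j) (z (Suc j)) \<le> psi_min (Suc j)"
proof -
  have INF: "(INF u\<in>Q. \<psi> j u) = \<psi> j (z j)" for j
    by (rule INF_eq_arg_min[OF arg_min_z])
  have psi0: "\<psi> 0 (z 0) = 0"
    using property1 unfolding property1_def INF by blast
  then show "psi_min 0 = 0"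
    by (simp add: psi_min_def)
  have step: "\<psi> j (z j) + ereal (lam j * lf (x j) (z (Suc j))) + ereal (bet (Suc j) * D (z (Suc j)))
      - ereal (bet j * ld (z j) (z (Suc j))) \<le> \<psi> (Suc j) (z (Suc j))" for j
    using property1 z_in[of "Suc j"] unfolding property1_def INF by (auto simp: d_eq)
  have upper: "\<psi> (Suc k) (z (Suc k)) \<noteq> \<infinity>" for k
  proof -
    have "\<psi> (Suc k) (z (Suc k)) \<le>
        (INF u\<in>Q. ereal ((\<Sum>i\<le>k. lam i * lf (x i) u) + bet (Suc k) * ld (z (Suc k)) u))"
      using property1 unfolding property1_def INF by blast
    also have "\<dots> \<le> ereal ((\<Sum>i\<le>k. lam i * lf (x i) x0) + bet (Suc k) * ld (z (Suc k)) x0)"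
      by (rule INF_lower[OF x0_in])
    finally show ?thesis by auto
  qed
  have fin: "\<psi> j (z j) = ereal (psi_min j)" for j
  proof (induction j)
    case 0
    then show ?case by (simp add: psi0 psi_min_def)
  next
    case (Suc j)
    then show ?case
      using step[of j] upper[of j] by (cases "\<psi> (Suc j) (z (Suc j))") (auto simp: psi_min_def[of "Suc j"])
  qed
  show "(INF u\<in>Q. \<psi> j u) = ereal (psi_min j)"
    using INF fin by simp
  show "psi_min j + lam j * lf (x j) (z (Suc j)) + bet (Suc j) * D (z (Suc j))
      - bet j * ld (z j) (z (Suc j)) \<le> psi_min (Suc j)"
    using step[of j] by (simp add: fin)
qed

lemma psi_min_Suc_le:
  assumes "u \<in> Q"
  shows "psi_min (Suc k) \<le> (\<Sum>i\<le>k. lam i * lf (x i) u) + bet (Suc k) * ld (z (Suc k)) u"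
proof -
  have "ereal (psi_min (Suc k)) \<le>
      (INF u\<in>Q. ereal ((\<Sum>i\<le>k. lam i * lf (x i) u) + bet (Suc k) * ld (z (Suc k)) u))"
    using property1 unfolding property1_def INF_eq by blast
  also have "\<dots> \<le> ereal ((\<Sum>i\<le>k. lam i * lf (x i) u) + bet (Suc k) * ld (z (Suc k)) u)"
    by (rule INF_lower[OF assms])
  finally show ?thesis by simp
qed

text \<open>
  In both procedures, one step leaves over the subgradient applied to the displacement
  \<open>z (Suc j) - z j\<close>; here \<open>r\<close> stands for the weighted objective value minus the earlier errors. The strong convexity
  of \<open>d\<close> provides \<open>\<sigma> * bet j / 2\<close> times the squared length of the same displacement, and Young's
  inequality trades the two terms for the error on the right. Replacing \<open>bet (Suc j)\<close> by \<open>bet j\<close>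
  costs nothing since \<open>d\<close> is nonnegative on \<open>Q\<close>.
\<close>

lemma psi_min_step:
  assumes "r + lam j * blinfun_apply (gs j) (z (Suc j) - z j)
      \<le> psi_min j + lam j * lf (x j) (z (Suc j))"
  shows "r \<le> psi_min (Suc j) + (lam j)\<^sup>2 * (norm (gs j))\<^sup>2 / (2 * \<sigma> * bet j)"
proof -
  define v where "v = z (Suc j) - z j"
  have "bet j * (ld (z j) (z (Suc j)) + \<sigma> / 2 * (norm v)\<^sup>2) \<le> bet j * D (z (Suc j))"
    unfolding v_def using ld_bregman z_in bet_pos[of j] by (intro mult_left_mono) auto
  also have "\<dots> \<le> bet (Suc j) * D (z (Suc j))"
    using bet_mono D_nonneg z_in by (intro mult_right_mono) auto
  finally have "r + (lam j * blinfun_apply (gs j) v + (\<sigma> * bet j) / 2 * (norm v)\<^sup>2) \<le> psi_min (Suc j)"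
    using assms psi_min_Suc_ge[of j] by (simp add: v_def algebra_simps)
  moreover have "- ((lam j)\<^sup>2 * (norm (gs j))\<^sup>2 / (2 * (\<sigma> * bet j)))
      \<le> lam j * blinfun_apply (gs j) v + (\<sigma> * bet j) / 2 * (norm v)\<^sup>2"
    using \<sigma>(1) bet_pos by (intro blinfun_young) simp
  ultimately show ?thesis
    by (simp add: mult.assoc)
qed

definition acc_err :: "nat \<Rightarrow> real" where
  "acc_err k = (\<Sum>i\<le>k. (lam i)\<^sup>2 * (norm (gs i))\<^sup>2 / (2 * \<sigma> * bet i))"

lemma sum_F_x_le:
  assumes "p = Proc_a"
  shows "(\<Sum>i\<le>k. lam i * F (x i)) \<le> psi_min (Suc k) + acc_err k"
proof (induction k)
  case 0
  then show ?case
    using psi_min_step[of "lam 0 * F (x 0)" 0] unfolding acc_err_def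
    by (simp add: assms psi_min_0 lf_eq ld_eq proc_a gs_eq algebra_simps)
next
  case (Suc k)
  then show ?case
    using psi_min_step[of "(\<Sum>i\<le>k. lam i * F (x i)) - acc_err k + lam (Suc k) * F (x (Suc k))" "Suc k"]
    unfolding acc_err_def
    by (simp add: assms lf_eq ld_eq proc_a gs_eq algebra_simps)
qed

text \<open>
  The subgradient inequality at the new point \<open>x (Suc k)\<close> moves the previous estimate from \<open>x k\<close> to
  \<open>x (Suc k)\<close>. As the weighted differences of the \<open>z i\<close> from \<open>x (Suc k)\<close> cancel, only the
  displacement \<open>z (Suc (Suc k)) - z (Suc k)\<close> is left in the linear term.
\<close>

lemma sum_lam_F_x_le:
  assumes p: "p = Proc_b"
  shows "(\<Sum>i\<le>k. lam i) * F (x k) \<le> psi_min (Suc k) + acc_err k"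
proof (induction k)
  case 0
  then show ?case
    using psi_min_step[of "lam 0 * F (x 0)" 0] unfolding acc_err_def
    by (simp add: psi_min_0 lf_eq ld_eq x_0 gs_eq algebra_simps)
next
  case (Suc k)
  define S where "S = (\<Sum>i\<le>k. lam i)"
  let ?y = "x (Suc k)"
  have avg: "(\<Sum>i\<le>k. lam i) *\<^sub>R x k = (\<Sum>i\<le>k. lam i *\<^sub>R z i)" for k
    using proc_b(2)[OF p, of k] sum_lam_pos[of k] by simp
  have "S *\<^sub>R x k + lam (Suc k) *\<^sub>R z (Suc k) = (S + lam (Suc k)) *\<^sub>R ?y"
    using avg[of k] avg[of "Suc k"] by (simp add: S_def)
  then have "blinfun_apply (g ?y) (S *\<^sub>R x k + lam (Suc k) *\<^sub>R z (Suc k))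
      = blinfun_apply (g ?y) ((S + lam (Suc k)) *\<^sub>R ?y)"
    by simp
  then have cancel: "S * blinfun_apply (g ?y) (x k - ?y) + lam (Suc k) * blinfun_apply (g ?y) (z (Suc k) - ?y) = 0"
    by (simp add: blinfun.add_right blinfun.scaleR_right blinfun.diff_right algebra_simps)
  have "S * lf ?y (x k) \<le> S * F (x k)"
    using lf_le[OF x_in x_in] sum_lam_pos[of k] by (intro mult_left_mono) (auto simp: S_def)
  then have "S * lf ?y (x k) \<le> psi_min (Suc k) + acc_err k"
    using Suc by (simp add: S_def)
  then have "(S + lam (Suc k)) * F ?y - acc_err k
      \<le> psi_min (Suc (Suc k)) + (lam (Suc k))\<^sup>2 * (norm (gs (Suc k)))\<^sup>2 / (2 * \<sigma> * bet (Suc k))"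
    using cancel
    by (intro psi_min_step) (simp add: lf_eq ld_eq gs_eq blinfun.diff_right algebra_simps)
  then show ?case
    by (simp add: acc_err_def S_def)
qed

text \<open>
  Jensen's inequality, from the subgradient at the average: the weighted differences
  \<open>x i - xh k\<close> add up to zero.
\<close>

lemma sum_F_ge_F_average:
  assumes "p = Proc_a"
  shows "(\<Sum>i\<le>k. lam i) * F (xh k) \<le> (\<Sum>i\<le>k. lam i * F (x i))"
proof -
  have "(\<Sum>i\<le>k. lam i) *\<^sub>R xh k = (\<Sum>i\<le>k. lam i *\<^sub>R x i)"
    using proc_a(2)[OF assms, of k] sum_lam_pos[of k] by simp
  then have "(\<Sum>i\<le>k. lam i *\<^sub>R (x i - xh k)) = 0"
    by (simp add: scaleR_diff_right sum_subtractf scaleR_sum_left)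
  then have "blinfun_apply (g (xh k)) (\<Sum>i\<le>k. lam i *\<^sub>R (x i - xh k)) = 0"
    by (simp add: blinfun.zero_right)
  then have "(\<Sum>i\<le>k. lam i * blinfun_apply (g (xh k)) (x i - xh k)) = 0"
    by (simp add: blinfun.sum_right blinfun.scaleR_right)
  then have "(\<Sum>i\<le>k. lam i) * F (xh k) = (\<Sum>i\<le>k. lam i * lf (xh k) (x i))"
    by (simp add: lf_eq ld_eq distrib_left sum.distrib sum_distrib_right)
  also have "\<dots> \<le> (\<Sum>i\<le>k. lam i * F (x i))"
    using lam_pos lf_le[OF xh_in x_in] by (intro sum_mono mult_left_mono) (auto simp: less_imp_le)
  finally show ?thesis .
qed

lemma sum_lam_F_xh_le: "(\<Sum>i\<le>k. lam i) * F (xh k) \<le> psi_min (Suc k) + acc_err k"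
proof (cases p)
  case Proc_a
  show ?thesis
    using sum_F_ge_F_average[OF Proc_a] sum_F_x_le[OF Proc_a] by (rule order_trans)
next
  case Proc_b
  then show ?thesis
    using sum_lam_F_x_le by (simp add: proc_b(1))
qed

lemma psi_min_Suc_le_xstar:
  "psi_min (Suc k) \<le> (\<Sum>i\<le>k. lam i) * F xstar + bet (Suc k) * ld (z (Suc k)) xstar"
proof -
  have "(\<Sum>i\<le>k. lam i * lf (x i) xstar) \<le> (\<Sum>i\<le>k. lam i) * F xstar"
    unfolding sum_distrib_right
    using lam_pos lf_le[OF x_in xstar_in] by (intro sum_mono mult_left_mono) (auto simp: less_imp_le)
  then show ?thesis
    using psi_min_Suc_le[OF xstar_in, of k] by linarith
qed

text \<open>
  The upper bound for the weighted optimality gap of \<open>xh k\<close> that the estimates of \<open>psi_min (Suc k)\<close> from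
  both sides provide.
\<close>

lemma gap_nonneg: "0 \<le> bet (Suc k) * ld (z (Suc k)) xstar + acc_err k"
proof -
  have "(\<Sum>i\<le>k. lam i) * F xstar \<le> (\<Sum>i\<le>k. lam i) * F (xh k)"
    using F_xstar_le[OF xh_in] sum_lam_pos by (intro mult_left_mono) (auto simp: less_imp_le)
  then show ?thesis
    using sum_lam_F_xh_le[of k] psi_min_Suc_le_xstar[of k] by linarith
qed

text \<open>
  The same fact read differently: \<open>ld (z (Suc k)) xstar\<close> falls short of \<open>D xstar\<close> by at least
  \<open>\<sigma>/2\<close> times the squared distance, so nonnegativity of the gap bounds that distance.
\<close>

lemma norm_z_Suc_le:
  "(norm (z (Suc k) - xstar))\<^sup>2 \<le> 2 * D xstar / \<sigma> + 2 * acc_err k / (\<sigma> * bet (Suc k))"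
proof -
  have "bet (Suc k) * (ld (z (Suc k)) xstar + \<sigma> / 2 * (norm (xstar - z (Suc k)))\<^sup>2) \<le> bet (Suc k) * D xstar"
    using bet_pos[of "Suc k"] ld_bregman[OF z_in xstar_in] by (intro mult_left_mono) auto
  then have "bet (Suc k) * (\<sigma> / 2 * (norm (z (Suc k) - xstar))\<^sup>2) \<le> bet (Suc k) * D xstar + acc_err k"
    using gap_nonneg[of k] by (simp add: norm_minus_commute distrib_left)
  then show ?thesis
    using bet_pos[of "Suc k"] \<sigma>(1) by (simp add: field_simps)
qed

lemma norm_z_0_le: "(norm (z 0 - xstar))\<^sup>2 \<le> 2 * D xstar / \<sigma>"
proof -
  have "d u = ereal (0 + blinfun_apply 0 u + 1 * D u)" if "u \<in> Q" for u
    using that by (simp add: d_eq)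
  from arg_min_affine_plus_prox[OF this x0(1) xstar_in] have "0 \<le> ld x0 xstar"
    by simp
  then have "\<sigma> / 2 * (norm (z 0 - xstar))\<^sup>2 \<le> D xstar"
    using ld_bregman[OF x0_in xstar_in] by (simp add: z_0 norm_minus_commute)
  then show ?thesis
    using \<sigma>(1) by (simp add: field_simps)
qed

text \<open>
  Both averaging schemes use \<open>bet j = b * beta_hat j\<close>; they differ in the bound \<open>c\<close> for the weighted
  subgradients and, in the rate, in the lower bound \<open>w\<close> for the total weight. The telescoping sum then makes \<open>err\<close>
  a multiple of the same \<open>beta_hat\<close>.
\<close>

lemma acc_err_le:
  assumes bet: "\<And>j. bet j = b * beta_hat j" and "b > 0"
    and c: "\<And>i. i \<le> k \<Longrightarrow> (lam i)\<^sup>2 * (norm (gs i))\<^sup>2 \<le> c"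
  shows "acc_err k \<le> c / (2 * \<sigma> * b) * beta_hat (Suc k)"
proof -
  have "acc_err k \<le> (\<Sum>i\<le>k. c / (2 * \<sigma> * b) * (1 / beta_hat i))"
    unfolding acc_err_def
  proof (rule sum_mono)
    fix i assume "i \<in> {..k}"
    then have "(lam i)\<^sup>2 * (norm (gs i))\<^sup>2 / (2 * \<sigma> * bet i) \<le> c / (2 * \<sigma> * bet i)"
      using c \<sigma>(1) bet_pos[of i] by (intro divide_right_mono) auto
    then show "(lam i)\<^sup>2 * (norm (gs i))\<^sup>2 / (2 * \<sigma> * bet i) \<le> c / (2 * \<sigma> * b) * (1 / beta_hat i)"
      by (simp add: bet mult.assoc)
  qed
  also have "\<dots> = c / (2 * \<sigma> * b) * beta_hat (Suc k)"
    by (simp only: sum_distrib_left[symmetric] sum_inverse_beta_hat)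
  finally show ?thesis .
qed

text \<open>
  Here \<open>V\<close> is either \<open>f (xh k)\<close> times the total weight or the weighted sum of the values \<open>f (x i)\<close>.
  The bracket is nonnegative although \<open>ld (z (Suc k)) xstar\<close> may be negative, because the
  optimality gap that it bounds is nonnegative. This is what allows replacing \<open>beta_hat\<close> and the total
  weight by their estimates.
\<close>

lemma rate:
  assumes bet: "\<And>j. bet j = b * beta_hat j" and b: "b > 0"
    and c: "\<And>i. i \<le> k \<Longrightarrow> (lam i)\<^sup>2 * (norm (gs i))\<^sup>2 \<le> c"
    and w: "0 < w" "w \<le> (\<Sum>i\<le>k. lam i)"
    and V: "V \<le> psi_min (Suc k) + acc_err k"
  shows "V / (\<Sum>i\<le>k. lam i) - F xstar
    \<le> (b * ld (z (Suc k)) xstar + c / (2 * \<sigma> * b)) * ((0.5 + sqrt (2 * real k + 1)) / w)"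
proof -
  define S where "S = (\<Sum>i\<le>k. lam i)"
  define R where "R = b * ld (z (Suc k)) xstar + c / (2 * \<sigma> * b)"
  have S: "0 < S" "w \<le> S"
    using w by (auto simp: S_def)
  have gap: "bet (Suc k) * ld (z (Suc k)) xstar + acc_err k \<le> R * beta_hat (Suc k)"
    using acc_err_le[OF bet b c] by (simp add: R_def bet algebra_simps)
  have "0 \<le> R * beta_hat (Suc k)"
    using gap gap_nonneg[of k] by linarith
  then have R: "0 \<le> R"
    using beta_hat_ge_1[of "Suc k"] by (simp add: zero_le_mult_iff)
  have "V - S * F xstar \<le> R * beta_hat (Suc k)"
    using V psi_min_Suc_le_xstar[of k] gap by (simp add: S_def)
  also have "\<dots> \<le> R * (0.5 + sqrt (2 * real k + 1))"
    using R beta_hat_le by (rule mult_left_mono[rotated])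
  finally have "(V - S * F xstar) / S \<le> R * (0.5 + sqrt (2 * real k + 1)) / S"
    using S(1) by (intro divide_right_mono) auto
  also have "\<dots> \<le> R * (0.5 + sqrt (2 * real k + 1)) / w"
    using R S w(1) by (intro divide_left_mono mult_nonneg_nonneg add_nonneg_nonneg) auto
  finally show ?thesis
    using S(1) by (simp add: S_def R_def diff_divide_distrib)
qed

lemma norm_z_le:
  assumes bet: "\<And>j. bet j = b * beta_hat j" and b: "b > 0"
    and c: "\<And>i. i < j \<Longrightarrow> (lam i)\<^sup>2 * (norm (gs i))\<^sup>2 \<le> c" "0 \<le> c"
  shows "(norm (z j - xstar))\<^sup>2 \<le> 2 * D xstar / \<sigma> + c / (\<sigma>\<^sup>2 * b\<^sup>2)"
proof (cases j)
  case 0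
  then show ?thesis
    using norm_z_0_le c(2) by (simp add: add_increasing2)
next
  case (Suc k)
  have "2 * acc_err k / (\<sigma> * bet (Suc k))
      \<le> 2 * (c / (2 * \<sigma> * b) * beta_hat (Suc k)) / (\<sigma> * bet (Suc k))"
    using acc_err_le[OF bet b, of k c] c(1) Suc \<sigma>(1) bet_pos[of "Suc k"]
    by (intro divide_right_mono) auto
  also have "\<dots> = c / (\<sigma>\<^sup>2 * b\<^sup>2)"
    using \<sigma>(1) b beta_hat_ge_1[of "Suc k"] by (simp add: bet field_simps power2_eq_square)
  finally show ?thesis
    using norm_z_Suc_le[of k] Suc by simp
qed

lemma iterates_in_ball:
  assumes "\<And>i. i \<le> j \<Longrightarrow> (norm (z i - xstar))\<^sup>2 \<le> r"
  shows "{z j, x j, xh j} \<subseteq> {u \<in> Q. (norm (u - xstar))\<^sup>2 \<le> r}"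
proof -
  have ball: "u \<in> cball xstar (sqrt r) \<longleftrightarrow> (norm (u - xstar))\<^sup>2 \<le> r" for u
  proof -
    have "(norm (u - xstar))\<^sup>2 \<le> r \<longleftrightarrow> norm (u - xstar) \<le> sqrt r"
      using real_sqrt_le_iff[of "(norm (u - xstar))\<^sup>2" r] by simp
    then show ?thesis
      by (simp add: dist_norm norm_minus_commute)
  qed
  show ?thesis
    using iterates_in_convex[OF convex_cball[of xstar "sqrt r"], of j, unfolded ball, OF assms]
      assms[of j] z_in x_in xh_in by blast
qed

text \<open>
  The points involved lie in \<open>Q\<close>, where \<open>f\<close> is finite, so the real estimates carry over to the
  extended reals. The hypothesis has the form of the lemma \<open>rate\<close>, applied to both choices of \<open>V\<close>.
\<close>

lemma ereal_bounds:
  assumes V: "\<And>V. V \<le> psi_min (Suc k) + acc_err k \<Longrightarrow> V / (\<Sum>i\<le>k. lam i) - F xstar \<le> B"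
  shows "f (xh k) - f xstar \<le> ereal B"
    and "p = Proc_a \<Longrightarrow>
       f (xh k) - f xstar
         \<le> ereal (1 / (\<Sum>i\<le>k. lam i)) * (\<Sum>i\<le>k. ereal (lam i) * f (x i)) - f xstar \<and>
       ereal (1 / (\<Sum>i\<le>k. lam i)) * (\<Sum>i\<le>k. ereal (lam i) * f (x i)) - f xstar \<le> ereal B \<and>
       min (f (xh k) - f xstar) (Min ((\<lambda>i. f (x i)) ` {..k}) - f xstar) \<le> ereal B"
proof -
  have S: "0 < (\<Sum>i\<le>k. lam i)"
    by (rule sum_lam_pos)
  have fx: "f (xh k) - f xstar = ereal (F (xh k) - F xstar)"
    by (simp add: f_eq xh_in xstar_in)
  show *: "f (xh k) - f xstar \<le> ereal B"
    using V[OF sum_lam_F_xh_le] S by (simp add: fx)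
  assume p: "p = Proc_a"
  have avg: "ereal (1 / (\<Sum>i\<le>k. lam i)) * (\<Sum>i\<le>k. ereal (lam i) * f (x i)) - f xstar
      = ereal ((\<Sum>i\<le>k. lam i * F (x i)) / (\<Sum>i\<le>k. lam i) - F xstar)"
    by (simp add: f_eq x_in xstar_in)
  have "F (xh k) \<le> (\<Sum>i\<le>k. lam i * F (x i)) / (\<Sum>i\<le>k. lam i)"
    using sum_F_ge_F_average[OF p, of k] S by (simp add: field_simps)
  then show "f (xh k) - f xstar
         \<le> ereal (1 / (\<Sum>i\<le>k. lam i)) * (\<Sum>i\<le>k. ereal (lam i) * f (x i)) - f xstar \<and>
       ereal (1 / (\<Sum>i\<le>k. lam i)) * (\<Sum>i\<le>k. ereal (lam i) * f (x i)) - f xstar \<le> ereal B \<and>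
       min (f (xh k) - f xstar) (Min ((\<lambda>i. f (x i)) ` {..k}) - f xstar) \<le> ereal B"
    unfolding avg using V[OF sum_F_x_le[OF p]] * by (simp add: fx min.coboundedI1)
qed

end

theorem corollary4p4:
  fixes Q :: "'a::real_normed_vector set"
    and f d :: "'a \<Rightarrow> ereal"
    and g Dd :: "'a \<Rightarrow> 'a \<Rightarrow>\<^sub>L real"
    and xstar x0 :: 'a
    and \<sigma> \<gamma> \<rho> :: real
    and p :: procedure
    and lam bet :: "nat \<Rightarrow> real"
    and \<psi> :: "nat \<Rightarrow> 'a \<Rightarrow> ereal"
    and z x xh :: "nat \<Rightarrow> 'a"
    and gs :: "nat \<Rightarrow> 'a \<Rightarrow>\<^sub>L real"
  assumes findim: "\<exists>B::'a set. finite B \<and> span B = UNIV"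
    and Q: "Q \<noteq> {}" "closed Q" "convex Q"
    and f: "proper_fun f" "lsc_fun f" "convex_fun f" "Q \<subseteq> eff_dom f"
    and xstar: "is_arg_min f (\<lambda>u. u \<in> Q) xstar"
    and d: "proper_fun d" "lsc_fun d" "convex_fun d" "cont_diff_on Q d Dd"
    and \<sigma>: "\<sigma> > 0" "strongly_convex_on \<sigma> Q d"
    and x0: "is_arg_min d (\<lambda>u. u \<in> Q) x0" "d x0 = 0"
    and g: "\<And>y. y \<in> Q \<Longrightarrow> g y \<in> subdifferential f y"
    and run: "subgradient_method p Q f g d Dd x0 lam bet \<psi> z x gs xh"
  shows
    "(\<gamma> > 0 \<and> (\<forall>k. lam k = 1) \<and> (\<forall>j. bet j = \<gamma> * beta_hat j) \<longrightarrow>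
       (let bound = (\<lambda>k. (\<gamma> * lin_model d Dd (z (Suc k)) xstar
                           + (run_max gs (Suc k))\<^sup>2 / (2 * \<sigma> * \<gamma>))
                         * ((0.5 + sqrt (2 * real k + 1)) / (real k + 1)))
        in
        (\<forall>k. f (xh k) - f xstar \<le> ereal (bound k)) \<and>
        (\<forall>j. {z j, x j, xh j} \<subseteq>
           {u \<in> Q. (norm (u - xstar))\<^sup>2 \<le>
              2 * real_of_ereal (d xstar) / \<sigma> + (run_max gs j)\<^sup>2 / (\<sigma>\<^sup>2 * \<gamma>\<^sup>2)}) \<and>
        (p = Proc_a \<longrightarrow> (\<forall>k.
           f (xh k) - f xstar
             \<le> ereal (1 / (\<Sum>i\<le>k. lam i)) * (\<Sum>i\<le>k. ereal (lam i) * f (x i)) - f xstar \<and>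
           ereal (1 / (\<Sum>i\<le>k. lam i)) * (\<Sum>i\<le>k. ereal (lam i) * f (x i)) - f xstar
             \<le> ereal (bound k) \<and>
           min (f (xh k) - f xstar) (Min ((\<lambda>i. f (x i)) ` {..k}) - f xstar)
             \<le> ereal (bound k)))))
     \<and>
     (\<rho> > 0 \<and> (\<forall>k. gs k \<noteq> 0) \<and> (\<forall>k. lam k = 1 / norm (gs k)) \<and>
      (\<forall>j. bet j = beta_hat j / (\<rho> * sqrt \<sigma>)) \<longrightarrow>
       (let bound = (\<lambda>k. run_max gs (Suc k) * (1 / sqrt \<sigma>)
                         * (lin_model d Dd (z (Suc k)) xstar / \<rho> + \<rho> / 2)
                         * ((0.5 + sqrt (2 * real k + 1)) / (real k + 1)))
        in
        (\<forall>k. f (xh k) - f xstar \<le> ereal (bound k)) \<and>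
        (\<forall>j. {z j, x j, xh j} \<subseteq>
           {u \<in> Q. (norm (u - xstar))\<^sup>2 \<le> (2 * real_of_ereal (d xstar) + \<rho>\<^sup>2) / \<sigma>}) \<and>
        (p = Proc_a \<longrightarrow> (\<forall>k.
           f (xh k) - f xstar
             \<le> ereal (1 / (\<Sum>i\<le>k. lam i)) * (\<Sum>i\<le>k. ereal (lam i) * f (x i)) - f xstar \<and>
           ereal (1 / (\<Sum>i\<le>k. lam i)) * (\<Sum>i\<le>k. ereal (lam i) * f (x i)) - f xstar
             \<le> ereal (bound k) \<and>
           min (f (xh k) - f xstar) (Min ((\<lambda>i. f (x i)) ` {..k}) - f xstar)
             \<le> ereal (bound k)))))"
proof -
  interpret subgradient_run Q f d g Dd xstar x0 \<sigma> p lam bet \<psi> z x xh gs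
    by unfold_locales (use assms in auto)
  show ?thesis
    unfolding Let_def D_def[symmetric]
  proof (intro conjI; intro impI)
    assume simple: "\<gamma> > 0 \<and> (\<forall>k. lam k = 1) \<and> (\<forall>j. bet j = \<gamma> * beta_hat j)"
    then have \<gamma>: "\<gamma> > 0" and lam: "lam k = 1" and bet: "bet j = \<gamma> * beta_hat j" for k j
      by auto
    let ?bound = "\<lambda>k. (\<gamma> * ld (z (Suc k)) xstar + (run_max gs (Suc k))\<^sup>2 / (2 * \<sigma> * \<gamma>))
                       * ((0.5 + sqrt (2 * real k + 1)) / (real k + 1))"
    have c: "(lam i)\<^sup>2 * (norm (gs i))\<^sup>2 \<le> (run_max gs j)\<^sup>2" if "i < j" for i j
    proof -
      from that obtain k where "j = Suc k" "i \<le> k"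
        by (cases j) auto
      then show ?thesis
        using norm_le_run_max[of i k gs] by (simp add: lam power_mono)
    qed
    have V: "V / (\<Sum>i\<le>k. lam i) - F xstar \<le> ?bound k" if "V \<le> psi_min (Suc k) + acc_err k" for V k
      using c that by (intro rate[OF bet \<gamma>]) (auto simp: lam simp del: run_max.simps)
    have z: "(norm (z i - xstar))\<^sup>2 \<le> 2 * D xstar / \<sigma> + (run_max gs j)\<^sup>2 / (\<sigma>\<^sup>2 * \<gamma>\<^sup>2)"
      if "i \<le> j" for i j
      using c that by (intro norm_z_le[OF bet \<gamma>]) auto
    show "(\<forall>k. f (xh k) - f xstar \<le> ereal (?bound k)) \<and>
        (\<forall>j. {z j, x j, xh j} \<subseteq>
           {u \<in> Q. (norm (u - xstar))\<^sup>2 \<le> 2 * D xstar / \<sigma> + (run_max gs j)\<^sup>2 / (\<sigma>\<^sup>2 * \<gamma>\<^sup>2)}) \<and>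
        (p = Proc_a \<longrightarrow> (\<forall>k.
           f (xh k) - f xstar
             \<le> ereal (1 / (\<Sum>i\<le>k. lam i)) * (\<Sum>i\<le>k. ereal (lam i) * f (x i)) - f xstar \<and>
           ereal (1 / (\<Sum>i\<le>k. lam i)) * (\<Sum>i\<le>k. ereal (lam i) * f (x i)) - f xstar
             \<le> ereal (?bound k) \<and>
           min (f (xh k) - f xstar) (Min ((\<lambda>i. f (x i)) ` {..k}) - f xstar) \<le> ereal (?bound k)))"
      by (intro conjI allI impI ereal_bounds(1)[OF V] iterates_in_ball[OF z] ereal_bounds(2)[OF V])
  next
    assume weighted: "\<rho> > 0 \<and> (\<forall>k. gs k \<noteq> 0) \<and> (\<forall>k. lam k = 1 / norm (gs k)) \<and>
      (\<forall>j. bet j = beta_hat j / (\<rho> * sqrt \<sigma>))"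
    define b where "b = 1 / (\<rho> * sqrt \<sigma>)"
    have \<rho>: "\<rho> > 0" and gs: "gs k \<noteq> 0" and lam: "lam k = 1 / norm (gs k)"
      and bet: "bet j = b * beta_hat j" for k j
      using weighted by (auto simp: b_def)
    have b: "b > 0"
      using \<rho> \<sigma> by (simp add: b_def)
    let ?bound = "\<lambda>k. run_max gs (Suc k) * (1 / sqrt \<sigma>) * (ld (z (Suc k)) xstar / \<rho> + \<rho> / 2)
                       * ((0.5 + sqrt (2 * real k + 1)) / (real k + 1))"
    \<comment> \<open>The weights normalize the subgradients, so the error bound no longer involves their norms; these
      enter only through the total weight, which is at least \<open>(k + 1) / run_max gs (Suc k)\<close>.\<close>
    have c: "(lam i)\<^sup>2 * (norm (gs i))\<^sup>2 \<le> 1" for i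
      using gs[of i] by (simp add: lam power_divide)
    have c_eq: "1 / (2 * \<sigma> * b) = \<rho> / 2 * (1 / sqrt \<sigma>)" "1 / (\<sigma>\<^sup>2 * b\<^sup>2) = \<rho>\<^sup>2 / \<sigma>"
      using \<sigma>(1) real_sqrt_mult_self[of \<sigma>]
      by (simp_all add: b_def field_simps power2_eq_square)
    have V: "V / (\<Sum>i\<le>k. lam i) - F xstar \<le> ?bound k" if V: "V \<le> psi_min (Suc k) + acc_err k" for V k
    proof -
      have M: "0 < run_max gs (Suc k)"
        using norm_le_run_max[of 0 k gs] gs[of 0] by (smt (verit) le0 zero_less_norm_iff)
      have "real (k + 1) * (1 / run_max gs (Suc k)) = (\<Sum>i\<le>k. 1 / run_max gs (Suc k))"
        by simp
      also have "\<dots> \<le> (\<Sum>i\<le>k. lam i)"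
        unfolding lam using norm_le_run_max[of _ k gs] gs M
        by (intro sum_mono divide_left_mono) auto
      finally have w: "(real k + 1) / run_max gs (Suc k) \<le> (\<Sum>i\<le>k. lam i)"
        by (simp add: add.commute)
      have "V / (\<Sum>i\<le>k. lam i) - F xstar \<le> (b * ld (z (Suc k)) xstar + 1 / (2 * \<sigma> * b))
          * ((0.5 + sqrt (2 * real k + 1)) / ((real k + 1) / run_max gs (Suc k)))"
        using M by (intro rate[OF bet b c _ w V]) simp
      also have "b * ld (z (Suc k)) xstar + 1 / (2 * \<sigma> * b)
          = (1 / sqrt \<sigma>) * (ld (z (Suc k)) xstar / \<rho> + \<rho> / 2)"
        unfolding c_eq by (simp add: b_def distrib_left mult.commute)
      finally show ?thesis
        by (simp only: divide_divide_eq_right mult_ac times_divide_eq_right times_divide_eq_left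
            divide_divide_eq_left)
    qed
    have z: "(norm (z i - xstar))\<^sup>2 \<le> (2 * D xstar + \<rho>\<^sup>2) / \<sigma>" for i
      using norm_z_le[OF bet b c, of i] unfolding c_eq by (simp add: add_divide_distrib)
    show "(\<forall>k. f (xh k) - f xstar \<le> ereal (?bound k)) \<and>
        (\<forall>j. {z j, x j, xh j} \<subseteq> {u \<in> Q. (norm (u - xstar))\<^sup>2 \<le> (2 * D xstar + \<rho>\<^sup>2) / \<sigma>}) \<and>
        (p = Proc_a \<longrightarrow> (\<forall>k.
           f (xh k) - f xstar
             \<le> ereal (1 / (\<Sum>i\<le>k. lam i)) * (\<Sum>i\<le>k. ereal (lam i) * f (x i)) - f xstar \<and>
           ereal (1 / (\<Sum>i\<le>k. lam i)) * (\<Sum>i\<le>k. ereal (lam i) * f (x i)) - f xstar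
             \<le> ereal (?bound k) \<and>
           min (f (xh k) - f xstar) (Min ((\<lambda>i. f (x i)) ` {..k}) - f xstar) \<le> ereal (?bound k)))"
      by (intro conjI allI impI ereal_bounds(1)[OF V] iterates_in_ball[OF z] ereal_bounds(2)[OF V])
  qed
qed

end
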